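(* Let $G$ be a locally compact group, let $\pi:G\to\mathcal{U}(\mathcal{H}_{\pi})$ and $\rho:G\to\mathcal{U}(\mathcal{H}_{\rho})$ be two square integrable representations, and let $g\in\mathcal{H}_{\pi}$ and $h\in\mathcal{H}_{\rho}$ be admissible vectors. Assume that the corresponding wavelet spaces intersect non-trivially, that is, $$\mathcal{W}_{g}(\mathcal{H}_{\pi})\cap\mathcal{W}_{h}(\mathcal{H}_{\rho})\neq\{0\}.$$ Then $\mathcal{W}_{g}(\mathcal{H}_{\pi})=\mathcal{W}_{h}(\mathcal{H}_{\rho})$ and there exists a unitary intertwining operator $T:\mathcal{H}_{\pi}\to\mathcal{H}_{\rho}$ (i.e. $T\pi(x)=\rho(x)T$ for all $x\in G$) satisfying $T(g)=h$.
   Context: Locally compact groups are Hausdorff, $L^2(G)$ is taken with respect to a fixed left Haar measure, and inner products are linear in the first argument. A unitary representation $\pi:G\to\mathcal{U}(\mathcal{H}_{\pi})$ is a group homomorphism into the unitary operators of a Hilbert space such that for all $f,g\in\mathcal{H}_\pi$ the function (wavelet transform) $\mathcal{W}_{g}f(x):=\langle f,\pi(x)g\rangle_{\mathcal{H}_\pi}$ is continuous on $G$. It is irreducible if its only closed invariant subspaces are $\{0\}$ and $\mathcal{H}_\pi$. A square integrable representation is an irreducible unitary representation $\pi$ for which there is a non-zero $g\in\mathcal{H}_\pi$ with $\mathcal{W}_g g\in L^2(G)$; such a $g$ is called a square integrable vector. By the Duflo-Moore theorem there is a unique positive, densely defined, injective operator $C_\pi$ on $\mathcal{H}_\pi$,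 whose domain consists of $0$ and the square integrable vectors, with $\langle\mathcal{W}_{g_1}f_1,\mathcal{W}_{g_2}f_2\rangle_{L^2(G)}=\langle f_1,f_2\rangle\,\overline{\langle C_\pi g_1,C_\pi g_2\rangle}$ for all $f_1,f_2\in\mathcal{H}_\pi$ and $g_1,g_2\in\mathrm{dom}(C_\pi)$. A square integrable vector $g$ is admissible if $\|C_\pi g\|=1$; equivalently, $\mathcal{W}_g:\mathcal{H}_\pi\to L^2(G)$ is an isometry. For $g$ admissible, the wavelet space is $\mathcal{W}_g(\mathcal{H}_\pi):=\{\mathcal{W}_g f: f\in\mathcal{H}_\pi\}\subset L^2(G)$. *)

theory Defs
  imports "HOL-Analysis.Analysis"
begin

section \<open>Complex Hilbert spaces\<close>

text \<open>
  The class extends \<^class>\<open>real_inner\<close> and \<^class>\<open>complete_space\<close>, so norm, topology and completeness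
  are those of the library; the last axiom identifies the real inner product with the real part of
  the complex one, hence \<open>norm x = sqrt (Re (cinner x x))\<close>.  The complex inner product is linear in
  its first argument.
\<close>

class complex_hilbert_space = real_inner + complete_space +
  fixes scaleC :: "complex \<Rightarrow> 'a \<Rightarrow> 'a"
    and cinner :: "'a \<Rightarrow> 'a \<Rightarrow> complex"
  assumes scaleC_add_right: "scaleC a (x + y) = scaleC a x + scaleC a y"
    and scaleC_add_left: "scaleC (a + b) x = scaleC a x + scaleC b x"
    and scaleC_scaleC: "scaleC a (scaleC b x) = scaleC (a * b) x"
    and scaleC_of_real: "scaleC (complex_of_real r) x = scaleR r x"
    and cinner_commute: "cinner x y = cnj (cinner y x)"
    and cinner_add_left: "cinner (x + y) z = cinner x z + cinner y z"
    and cinner_scaleC_left: "cinner (scaleC a x) y = a * cinner x y"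
    and Re_cinner: "Re (cinner x y) = inner x y"

definition csubspace :: "'h::complex_hilbert_space set \<Rightarrow> bool" where
  "csubspace V \<longleftrightarrow> 0 \<in> V \<and> (\<forall>x\<in>V. \<forall>y\<in>V. x + y \<in> V) \<and> (\<forall>a. \<forall>x\<in>V. scaleC a x \<in> V)"

definition clinear_on ::
    "'h::complex_hilbert_space set \<Rightarrow> ('h \<Rightarrow> 'k::complex_hilbert_space) \<Rightarrow> bool" where
  "clinear_on D T \<longleftrightarrow>
     (\<forall>x\<in>D. \<forall>y\<in>D. T (x + y) = T x + T y) \<and> (\<forall>a. \<forall>x\<in>D. T (scaleC a x) = scaleC a (T x))"

definition unitary :: "('h::complex_hilbert_space \<Rightarrow> 'k::complex_hilbert_space) \<Rightarrow> bool" where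
  "unitary T \<longleftrightarrow> clinear_on UNIV T \<and> surj T \<and> (\<forall>x y. cinner (T x) (T y) = cinner x y)"


section \<open>Haar measure and square integrable functions\<close>

text \<open>
  Topological groups are written additively, after \<^class>\<open>topological_group_add\<close>, which does not
  require commutativity: \<open>x + y\<close> is the product \<open>xy\<close>, and \<open>0\<close> is the identity.
  A left Haar measure is a non-zero left invariant Radon measure on the Borel sets.
\<close>

definition left_haar_measure :: "'g::{topological_group_add, t2_space} measure \<Rightarrow> bool" where
  "left_haar_measure \<mu> \<longleftrightarrow>
     sets \<mu> = sets borel \<and>
     emeasure \<mu> UNIV \<noteq> 0 \<and>
     (\<forall>a. \<forall>A\<in>sets borel. emeasure \<mu> ((\<lambda>x. a + x) ` A) = emeasure \<mu> A) \<and>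
     (\<forall>K. compact K \<longrightarrow> emeasure \<mu> K < \<infinity>) \<and>
     (\<forall>A\<in>sets borel. emeasure \<mu> A = (INF U\<in>{U. open U \<and> A \<subseteq> U}. emeasure \<mu> U)) \<and>
     (\<forall>U. open U \<longrightarrow> emeasure \<mu> U = (SUP K\<in>{K. compact K \<and> K \<subseteq> U}. emeasure \<mu> K))"

definition square_integrable :: "'g measure \<Rightarrow> ('g \<Rightarrow> complex) \<Rightarrow> bool" where
  "square_integrable \<mu> u \<longleftrightarrow> u \<in> borel_measurable \<mu> \<and> integrable \<mu> (\<lambda>x. (cmod (u x))\<^sup>2)"

definition L2_inner :: "'g measure \<Rightarrow> ('g \<Rightarrow> complex) \<Rightarrow> ('g \<Rightarrow> complex) \<Rightarrow> complex" where
  "L2_inner \<mu> u v = (LINT x|\<mu>. u x * cnj (v x))"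

text \<open>The element of \<open>L\<^sup>2\<close> represented by \<open>u\<close>: its class modulo equality almost everywhere.\<close>

definition L2_class :: "'g measure \<Rightarrow> ('g \<Rightarrow> complex) \<Rightarrow> ('g \<Rightarrow> complex) set" where
  "L2_class \<mu> u = {v. square_integrable \<mu> v \<and> (AE x in \<mu>. v x = u x)}"


section \<open>Square integrable representations\<close>

definition wavelet_transform ::
    "('g \<Rightarrow> 'h \<Rightarrow> 'h::complex_hilbert_space) \<Rightarrow> 'h \<Rightarrow> 'h \<Rightarrow> 'g \<Rightarrow> complex" where
  "wavelet_transform \<pi> g f = (\<lambda>x. cinner f (\<pi> x g))"

definition unitary_representation ::
    "('g::topological_group_add \<Rightarrow> 'h \<Rightarrow> 'h::complex_hilbert_space) \<Rightarrow> bool" where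
  "unitary_representation \<pi> \<longleftrightarrow>
     (\<forall>x. unitary (\<pi> x)) \<and>
     (\<forall>x y. \<pi> (x + y) = \<pi> x \<circ> \<pi> y) \<and>
     (\<forall>f g. continuous_on UNIV (wavelet_transform \<pi> g f))"

definition irreducible_representation ::
    "('g::topological_group_add \<Rightarrow> 'h \<Rightarrow> 'h::complex_hilbert_space) \<Rightarrow> bool" where
  "irreducible_representation \<pi> \<longleftrightarrow>
     (\<forall>V. closed V \<and> csubspace V \<and> (\<forall>x. \<pi> x ` V \<subseteq> V) \<longrightarrow> V = {0} \<or> V = UNIV)"

definition square_integrable_vector ::
    "'g measure \<Rightarrow> ('g \<Rightarrow> 'h \<Rightarrow> 'h::complex_hilbert_space) \<Rightarrow> 'h \<Rightarrow> bool" where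
  "square_integrable_vector \<mu> \<pi> g \<longleftrightarrow>
     g \<noteq> 0 \<and> square_integrable \<mu> (wavelet_transform \<pi> g g)"

definition square_integrable_representation ::
    "'g::topological_group_add measure \<Rightarrow> ('g \<Rightarrow> 'h \<Rightarrow> 'h::complex_hilbert_space) \<Rightarrow> bool" where
  "square_integrable_representation \<mu> \<pi> \<longleftrightarrow>
     unitary_representation \<pi> \<and> irreducible_representation \<pi> \<and>
     (\<exists>g. square_integrable_vector \<mu> \<pi> g)"


section \<open>The Duflo-Moore operator and admissible vectors\<close>

text \<open>
  The unbounded operator \<open>C\<close> is given by a total function of which only the values on the domain
  matter.  Square integrability of the wavelet transforms is required explicitly because the
  integral defining \<^const>\<open>L2_inner\<close> is 0 when it does not converge.
\<close>

definition duflo_moore_domain ::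
    "'g measure \<Rightarrow> ('g \<Rightarrow> 'h \<Rightarrow> 'h::complex_hilbert_space) \<Rightarrow> 'h set" where
  "duflo_moore_domain \<mu> \<pi> = {0} \<union> {g. square_integrable_vector \<mu> \<pi> g}"

definition duflo_moore_operator ::
    "'g measure \<Rightarrow> ('g \<Rightarrow> 'h \<Rightarrow> 'h::complex_hilbert_space) \<Rightarrow> ('h \<Rightarrow> 'h) \<Rightarrow> bool" where
  "duflo_moore_operator \<mu> \<pi> C \<longleftrightarrow>
     (let D = duflo_moore_domain \<mu> \<pi> in
       csubspace D \<and> closure D = UNIV \<and>
       clinear_on D C \<and> inj_on C D \<and>
       (\<forall>g\<in>D. cinner (C g) g \<in> \<real>\<^sub>\<ge>\<^sub>0) \<and>
       (\<forall>g\<in>D. \<forall>f. square_integrable \<mu> (wavelet_transform \<pi> g f)) \<and>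
       (\<forall>g1\<in>D. \<forall>g2\<in>D. \<forall>f1 f2.
          L2_inner \<mu> (wavelet_transform \<pi> g1 f1) (wavelet_transform \<pi> g2 f2)
            = cinner f1 f2 * cnj (cinner (C g1) (C g2))))"

text \<open>
  The orthogonality relations determine \<open>cinner (C g1) (C g2)\<close>, so the value \<open>norm (C g)\<close> in the
  definition of admissibility does not depend on the choice of \<open>C\<close>.
\<close>

lemma duflo_moore_operator_norm_unique:
  assumes C: "duflo_moore_operator \<mu> \<pi> C" and C': "duflo_moore_operator \<mu> \<pi> C'"
    and g: "g \<in> duflo_moore_domain \<mu> \<pi>"
  shows "norm (C g) = norm (C' g)"
proof (cases "g = 0")
  case True
  have "B g = 0" if B: "duflo_moore_operator \<mu> \<pi> B" for B
  proof -
    have "B (0 + 0) = B 0 + B 0"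
      using B g True unfolding duflo_moore_operator_def Let_def clinear_on_def by blast
    then show ?thesis using True by simp
  qed
  from this[OF C] this[OF C'] show ?thesis by simp
next
  case False
  have "cinner g g * cnj (cinner (C g) (C g)) = cinner g g * cnj (cinner (C' g) (C' g))"
    using C C' g unfolding duflo_moore_operator_def Let_def by metis
  moreover have "cinner g g \<noteq> 0"
    using False Re_cinner[of g g] by auto
  ultimately have "cinner (C g) (C g) = cinner (C' g) (C' g)"
    by simp
  then show ?thesis
    by (metis Re_cinner norm_eq_sqrt_inner)
qed

definition admissible ::
    "'g measure \<Rightarrow> ('g \<Rightarrow> 'h \<Rightarrow> 'h::complex_hilbert_space) \<Rightarrow> 'h \<Rightarrow> bool" where
  "admissible \<mu> \<pi> g \<longleftrightarrow>
     square_integrable_vector \<mu> \<pi> g \<and> (\<exists>C. duflo_moore_operator \<mu> \<pi> C \<and> norm (C g) = 1)"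

definition wavelet_space ::
    "'g measure \<Rightarrow> ('g \<Rightarrow> 'h \<Rightarrow> 'h::complex_hilbert_space) \<Rightarrow> 'h \<Rightarrow> ('g \<Rightarrow> complex) set set" where
  "wavelet_space \<mu> \<pi> g = range (\<lambda>f. L2_class \<mu> (wavelet_transform \<pi> g f))"

end

theory Submission
  imports Defs
begin

text \<open>
  For an admissible vector \<open>g\<close> the wavelet transform \<open>f \<mapsto> W\<^sub>g f\<close> is a linear isometry into \<open>L\<^sup>2\<close>
  (orthogonality relations) that intertwines the representation with left translation.  Hence the
  vectors \<open>f\<close> whose transform is also a transform \<open>W\<^sub>h f'\<close> form an invariant subspace of the first
  Hilbert space.  It is closed: when \<open>f\<^sub>n \<longlonglongrightarrow> f\<close>, the partners \<open>f'\<^sub>n\<close> have the same mutual distances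
  as the \<open>f\<^sub>n\<close>, so they converge to some \<open>f'\<close>, and \<open>W\<^sub>g f = W\<^sub>h f'\<close> follows because the transforms
  converge pointwise.  If the wavelet spaces meet non-trivially, irreducibility makes this subspace
  everything (\<open>ex_equal_wavelet_transform\<close>); by symmetry the two wavelet spaces agree.

  The intertwiner is then \<open>T = W\<^sub>h\<^sup>-\<^sup>1 W\<^sub>g\<close>.  It sends \<open>g\<close> to \<open>h\<close> because evaluating
  \<open>W\<^sub>g f = W\<^sub>h (T f)\<close> at the identity gives \<open>\<langle>T f, T g\<rangle> = \<langle>f, g\<rangle> = \<langle>T f, h\<rangle>\<close> for all \<open>f\<close>, and \<open>T\<close> is
  onto.  The evaluation at a point is meaningful since wavelet transforms are continuous and a Haar
  measure charges every non-empty open set: equality almost everywhere is equality everywhere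
  (\<open>continuous_AE_eq_imp_eq\<close>).
\<close>

section \<open>Complex inner products\<close>

lemma cinner_add_right: "cinner x (y + z) = cinner x y + cinner x z"
  by (metis cinner_add_left cinner_commute complex_cnj_add)

lemma cinner_scaleC_right: "cinner x (scaleC a y) = cnj a * cinner x y"
  by (metis cinner_commute cinner_scaleC_left complex_cnj_mult)

lemma scaleC_minus_one: "scaleC (-1) x = - x"
  using scaleC_of_real[of "-1" x] by simp

lemma cinner_minus_left: "cinner (- x) y = - cinner x y"
  using cinner_scaleC_left[of "-1" x y] by (simp add: scaleC_minus_one)

lemma cinner_diff_left: "cinner (x - y) z = cinner x z - cinner y z"
  using cinner_add_left[of x "-y" z] by (simp add: cinner_minus_left)

lemma cinner_diff_right: "cinner x (y - z) = cinner x y - cinner x z"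
  by (metis cinner_diff_left cinner_commute complex_cnj_diff)

lemma cinner_zero_left: "cinner 0 y = 0"
  using cinner_diff_left[of 0 0 y] by simp

lemma cinner_self: "cinner x x = complex_of_real ((norm x)\<^sup>2)"
proof (rule complex_eqI)
  have "Im (cinner x x) = - Im (cinner x x)"
    by (subst cinner_commute) simp
  then show "Im (cinner x x) = Im (complex_of_real ((norm x)\<^sup>2))" by simp
qed (simp add: Re_cinner power2_norm_eq_inner)

text \<open>Continuity of the complex inner product thus reduces to that of the real one.\<close>

lemma cinner_eq_Complex: "cinner x y = Complex (inner x y) (inner x (scaleC \<i> y))"
proof (rule complex_eqI)
  have "Re (cinner x (scaleC \<i> y)) = Im (cinner x y)"
    by (simp add: cinner_scaleC_right)
  then show "Im (cinner x y) = Im (Complex (inner x y) (inner x (scaleC \<i> y)))"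
    by (simp add: Re_cinner)
qed (simp add: Re_cinner)

lemma tendsto_cinner_left:
  assumes "(f \<longlongrightarrow> x) F"
  shows "((\<lambda>n. cinner (f n) y) \<longlongrightarrow> cinner x y) F"
  unfolding cinner_eq_Complex
  by (intro tendsto_Complex tendsto_inner tendsto_const assms)


section \<open>Haar measures charge open sets\<close>

text \<open>
  Finitely many translates of a non-empty open set cover a given compact set; if they were null
  sets, every compact set would be null, and so would the whole group, by inner regularity.
\<close>

lemma left_haar_measure_open_pos:
  fixes \<mu> :: "'g::{topological_group_add, t2_space} measure"
  assumes haar: "left_haar_measure \<mu>" and U: "open U" "U \<noteq> {}"
  shows "emeasure \<mu> U \<noteq> 0"
proof
  assume null: "emeasure \<mu> U = 0"
  have sets: "sets \<mu> = sets borel"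
    and inv: "\<forall>a. \<forall>A\<in>sets borel. emeasure \<mu> ((\<lambda>x. a + x) ` A) = emeasure \<mu> A"
    and inner_regular:
      "\<forall>V. open V \<longrightarrow> emeasure \<mu> V = (SUP K\<in>{K. compact K \<and> K \<subseteq> V}. emeasure \<mu> K)"
    and nonzero: "emeasure \<mu> UNIV \<noteq> 0"
    by (insert haar, unfold left_haar_measure_def, elim conjE, assumption)+
  have open_translate: "open ((\<lambda>x. a + x) ` U)" for a
  proof -
    have "(\<lambda>x. a + x) ` U = (\<lambda>x. - a + x) -` U"
    proof (intro set_eqI iffI)
      fix y assume "y \<in> (\<lambda>x. - a + x) -` U"
      then show "y \<in> (\<lambda>x. a + x) ` U"
        by (intro image_eqI[of _ _ "- a + y"]) (auto simp flip: add.assoc)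
    qed (auto simp flip: add.assoc)
    moreover have "open ((\<lambda>x. - a + x) -` U)"
      by (intro open_vimage U continuous_intros)
    ultimately show ?thesis by simp
  qed
  have null_translate: "(\<lambda>x. a + x) ` U \<in> null_sets \<mu>" for a
    using bspec[OF spec[OF inv, of a], of U] null open_translate[of a] U sets by (auto simp: null_sets_def)
  obtain u where u: "u \<in> U" using U by blast
  have "emeasure \<mu> K = 0" if K: "compact K" for K
  proof -
    have "y \<in> (\<lambda>x. (y - u) + x) ` U" for y
      using u by (intro image_eqI[of _ _ u]) auto
    then have cover: "K \<subseteq> (\<Union>a\<in>UNIV. (\<lambda>x. a + x) ` U)" by blast
    obtain A where A: "finite A" "K \<subseteq> (\<Union>a\<in>A. (\<lambda>x. a + x) ` U)"
      by (rule compactE_image[OF K open_translate cover]) (rule that)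
    have "(\<Union>a\<in>A. (\<lambda>x. a + x) ` U) \<in> null_sets \<mu>"
      using A(1) null_translate by (intro null_sets_UN' countable_finite) auto
    then show ?thesis
      using A(2) by (metis emeasure_eq_0 null_setsD1 null_setsD2)
  qed
  then have "emeasure \<mu> UNIV \<le> 0"
    unfolding inner_regular[rule_format, OF open_UNIV] by (intro SUP_least) auto
  then show False using nonzero by simp
qed

lemma continuous_AE_eq_imp_eq:
  fixes \<mu> :: "'g::{topological_group_add, t2_space} measure" and u v :: "'g \<Rightarrow> 'b::t2_space"
  assumes haar: "left_haar_measure \<mu>"
    and cont: "continuous_on UNIV u" "continuous_on UNIV v"
    and AE: "AE x in \<mu>. u x = v x"
  shows "u = v"
proof -
  have sets: "sets \<mu> = sets borel" using haar unfolding left_haar_measure_def by (elim conjE)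
  have space: "space \<mu> = UNIV" using sets_eq_imp_space_eq[OF sets] by simp
  have op: "open {x. u x \<noteq> v x}"
    by (rule open_Collect_neq[OF cont])
  then have "{x. u x \<noteq> v x} \<in> sets \<mu>" using sets by auto
  then have "emeasure \<mu> {x. u x \<noteq> v x} = 0"
    using AE_iff_measurable[of "{x. u x \<noteq> v x}" \<mu> "\<lambda>x. u x = v x"] AE space by simp
  then have "{x. u x \<noteq> v x} = {}"
    using left_haar_measure_open_pos[OF haar op] by blast
  then show ?thesis by blast
qed


section \<open>Wavelet transforms\<close>

lemma wavelet_transform_add:
  "wavelet_transform \<pi> g (f1 + f2) = (\<lambda>x. wavelet_transform \<pi> g f1 x + wavelet_transform \<pi> g f2 x)"
  by (simp add: wavelet_transform_def cinner_add_left)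

lemma wavelet_transform_diff:
  "wavelet_transform \<pi> g (f1 - f2) = (\<lambda>x. wavelet_transform \<pi> g f1 x - wavelet_transform \<pi> g f2 x)"
  by (simp add: wavelet_transform_def cinner_diff_left)

lemma wavelet_transform_scaleC:
  "wavelet_transform \<pi> g (scaleC a f) = (\<lambda>x. a * wavelet_transform \<pi> g f x)"
  by (simp add: wavelet_transform_def cinner_scaleC_left)

lemma wavelet_transform_zero: "wavelet_transform \<pi> g 0 = (\<lambda>x. 0)"
  by (simp add: wavelet_transform_def cinner_zero_left)

lemma wavelet_transform_left_translate:
  assumes "unitary_representation \<pi>"
  shows "wavelet_transform \<pi> g (\<pi> y f) = (\<lambda>x. wavelet_transform \<pi> g f (- y + x))"
proof
  fix x
  have "\<pi> x g = \<pi> y (\<pi> (- y + x) g)"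
    using assms unfolding unitary_representation_def
    by (metis add.assoc add.left_neutral add.right_inverse comp_apply)
  moreover have "cinner (\<pi> y a) (\<pi> y b) = cinner a b" for a b
    using assms unfolding unitary_representation_def unitary_def by blast
  ultimately show "wavelet_transform \<pi> g (\<pi> y f) x = wavelet_transform \<pi> g f (- y + x)"
    by (simp add: wavelet_transform_def)
qed

lemma unitary_representation_zero:
  assumes "unitary_representation \<pi>"
  shows "\<pi> 0 f = f"
proof -
  have "surj (\<pi> 0)" and hom: "\<pi> 0 = \<pi> 0 \<circ> \<pi> 0"
    using assms unfolding unitary_representation_def unitary_def by (blast, metis add_0)
  then obtain e where "f = \<pi> 0 e" by blast
  then show ?thesis using hom by (metis comp_apply)
qed

lemma admissible_square_integrable:
  assumes "admissible \<mu> \<pi> g"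
  shows "square_integrable \<mu> (wavelet_transform \<pi> g f)"
  using assms unfolding admissible_def duflo_moore_operator_def duflo_moore_domain_def Let_def
  by blast

lemma admissible_L2_inner:
  assumes "admissible \<mu> \<pi> g"
  shows "L2_inner \<mu> (wavelet_transform \<pi> g f1) (wavelet_transform \<pi> g f2) = cinner f1 f2"
proof -
  obtain C where C: "duflo_moore_operator \<mu> \<pi> C" "norm (C g) = 1"
    and g: "g \<in> duflo_moore_domain \<mu> \<pi>"
    using assms unfolding admissible_def duflo_moore_domain_def by blast
  have "L2_inner \<mu> (wavelet_transform \<pi> g f1) (wavelet_transform \<pi> g f2)
      = cinner f1 f2 * cnj (cinner (C g) (C g))"
    using C(1) g unfolding duflo_moore_operator_def Let_def by blast
  then show ?thesis by (simp add: cinner_self C(2))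
qed

lemma cinner_eq_if_wavelet_transform_eq:
  assumes "admissible \<mu> \<pi> g" "admissible \<mu> \<rho> h"
    and "wavelet_transform \<pi> g f1 = wavelet_transform \<rho> h k1"
    and "wavelet_transform \<pi> g f2 = wavelet_transform \<rho> h k2"
  shows "cinner k1 k2 = cinner f1 f2"
  using admissible_L2_inner[OF assms(1), of f1 f2] admissible_L2_inner[OF assms(2), of k1 k2]
    assms(3,4) by simp

lemma norm_eq_if_wavelet_transform_eq:
  assumes "admissible \<mu> \<pi> g" "admissible \<mu> \<rho> h"
    and "wavelet_transform \<pi> g f = wavelet_transform \<rho> h k"
  shows "norm k = norm f"
proof -
  have "inner k k = inner f f"
    using cinner_eq_if_wavelet_transform_eq[OF assms assms(3)] by (metis Re_cinner)
  then show ?thesis by (simp add: norm_eq_sqrt_inner)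
qed

lemma inj_wavelet_transform:
  assumes "admissible \<mu> \<pi> g" "wavelet_transform \<pi> g f1 = wavelet_transform \<pi> g f2"
  shows "f1 = f2"
proof -
  have "wavelet_transform \<pi> g (f1 - f2) = wavelet_transform \<pi> g 0"
    by (simp add: wavelet_transform_diff wavelet_transform_zero assms(2))
  then have "norm (f1 - f2) = norm (0 :: 'b)"
    using norm_eq_if_wavelet_transform_eq[OF assms(1) assms(1)] by metis
  then show ?thesis by simp
qed

text \<open>
  The only step that needs more than algebra is closedness of the subspace of all \<open>f\<close> with a
  partner; there the isometry property transfers the Cauchy property to the partners.
\<close>

lemma ex_equal_wavelet_transform:
  fixes \<pi> :: "'g::topological_group_add \<Rightarrow> 'h \<Rightarrow> 'h::complex_hilbert_space"
    and \<rho> :: "'g \<Rightarrow> 'k \<Rightarrow> 'k::complex_hilbert_space"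
  assumes reps: "unitary_representation \<pi>" "unitary_representation \<rho>"
    and irred: "irreducible_representation \<pi>"
    and adm: "admissible \<mu> \<pi> g" "admissible \<mu> \<rho> h"
    and common: "wavelet_transform \<pi> g f0 = wavelet_transform \<rho> h k0" "f0 \<noteq> 0"
  shows "\<exists>k. wavelet_transform \<pi> g f = wavelet_transform \<rho> h k"
proof -
  define V where "V = {f. \<exists>k. wavelet_transform \<pi> g f = wavelet_transform \<rho> h k}"
  have "csubspace V"
    unfolding csubspace_def
  proof (intro conjI ballI allI)
    show "0 \<in> V" unfolding V_def mem_Collect_eq
      by (intro exI[of _ 0]) (simp add: wavelet_transform_zero)
    show "x + y \<in> V" if xy: "x \<in> V" "y \<in> V" for x y
    proof -
      obtain k l where "wavelet_transform \<pi> g x = wavelet_transform \<rho> h k"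
        "wavelet_transform \<pi> g y = wavelet_transform \<rho> h l"
        using xy unfolding V_def by blast
      then have "wavelet_transform \<pi> g (x + y) = wavelet_transform \<rho> h (k + l)"
        by (simp add: wavelet_transform_add)
      then show ?thesis unfolding V_def by blast
    qed
    show "scaleC a x \<in> V" if x: "x \<in> V" for a x
    proof -
      obtain k where "wavelet_transform \<pi> g x = wavelet_transform \<rho> h k"
        using x unfolding V_def by blast
      then have "wavelet_transform \<pi> g (scaleC a x) = wavelet_transform \<rho> h (scaleC a k)"
        by (simp add: wavelet_transform_scaleC)
      then show ?thesis unfolding V_def by blast
    qed
  qed
  moreover have "\<pi> x ` V \<subseteq> V" for x
  proof (rule image_subsetI)
    fix f assume "f \<in> V"
    then obtain k where "wavelet_transform \<pi> g f = wavelet_transform \<rho> h k"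
      unfolding V_def by blast
    then have "wavelet_transform \<pi> g (\<pi> x f) = wavelet_transform \<rho> h (\<rho> x k)"
      by (simp add: wavelet_transform_left_translate reps)
    then show "\<pi> x f \<in> V" unfolding V_def by blast
  qed
  moreover have "closed V"
    unfolding closed_sequential_limits
  proof (intro allI impI, elim conjE)
    fix F l assume F: "\<forall>n. F n \<in> V" and lim: "F \<longlonglongrightarrow> l"
    then obtain K where K: "\<And>n. wavelet_transform \<pi> g (F n) = wavelet_transform \<rho> h (K n)"
      unfolding V_def mem_Collect_eq by metis
    have "wavelet_transform \<pi> g (F m - F n) = wavelet_transform \<rho> h (K m - K n)" for m n
      by (simp add: wavelet_transform_diff K)
    then have "dist (K m) (K n) = dist (F m) (F n)" for m n
      unfolding dist_norm by (rule norm_eq_if_wavelet_transform_eq[OF adm])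
    then have "Cauchy K"
      using LIMSEQ_imp_Cauchy[OF lim] unfolding Cauchy_def by simp
    then obtain k where k: "K \<longlonglongrightarrow> k"
      using Cauchy_convergent convergent_def by blast
    have "wavelet_transform \<pi> g l x = wavelet_transform \<rho> h k x" for x
    proof (rule LIMSEQ_unique)
      show "(\<lambda>n. wavelet_transform \<pi> g (F n) x) \<longlonglongrightarrow> wavelet_transform \<pi> g l x"
        unfolding wavelet_transform_def by (rule tendsto_cinner_left[OF lim])
      show "(\<lambda>n. wavelet_transform \<pi> g (F n) x) \<longlonglongrightarrow> wavelet_transform \<rho> h k x"
        unfolding K unfolding wavelet_transform_def by (rule tendsto_cinner_left[OF k])
    qed
    then show "l \<in> V" unfolding V_def by blast
  qed
  ultimately have "V = {0} \<or> V = UNIV"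
    using irred unfolding irreducible_representation_def by blast
  moreover have "f0 \<in> V" using common(1) unfolding V_def by blast
  ultimately show ?thesis using common(2) unfolding V_def by blast
qed

text \<open>
  Without square integrability of \<open>u\<close> both classes could be empty.
\<close>

lemma L2_class_eq_imp_AE_eq:
  assumes "square_integrable \<mu> u" "L2_class \<mu> u = L2_class \<mu> v"
  shows "AE x in \<mu>. u x = v x"
proof -
  have "u \<in> L2_class \<mu> u" using assms(1) unfolding L2_class_def by simp
  then show ?thesis using assms(2) unfolding L2_class_def by blast
qed


section \<open>Intersecting wavelet spaces\<close>

theorem theorem1p1:
  fixes \<mu> :: "'g::{topological_group_add, t2_space} measure"
    and \<pi> :: "'g \<Rightarrow> 'h \<Rightarrow> 'h::complex_hilbert_space"
    and \<rho> :: "'g \<Rightarrow> 'k \<Rightarrow> 'k::complex_hilbert_space"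
    and g :: 'h and h :: 'k
  assumes "locally compact (UNIV :: 'g set)"
    and "left_haar_measure \<mu>"
    and "square_integrable_representation \<mu> \<pi>"
    and "square_integrable_representation \<mu> \<rho>"
    and "admissible \<mu> \<pi> g"
    and "admissible \<mu> \<rho> h"
    and "wavelet_space \<mu> \<pi> g \<inter> wavelet_space \<mu> \<rho> h \<noteq> {L2_class \<mu> (\<lambda>x. 0)}"
  shows "wavelet_space \<mu> \<pi> g = wavelet_space \<mu> \<rho> h \<and>
    (\<exists>T :: 'h \<Rightarrow> 'k. unitary T \<and> (\<forall>x. T \<circ> \<pi> x = \<rho> x \<circ> T) \<and> T g = h)"
proof -
  have \<pi>: "unitary_representation \<pi>" "irreducible_representation \<pi>"
    and \<rho>: "unitary_representation \<rho>" "irreducible_representation \<rho>"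
    using assms(3,4) unfolding square_integrable_representation_def by blast+
  note adm = assms(5,6)
  have zero_mem: "L2_class \<mu> (\<lambda>x. 0) \<in> wavelet_space \<mu> \<pi> g \<inter> wavelet_space \<mu> \<rho> h"
    unfolding wavelet_space_def
    by (auto intro!: image_eqI[of _ _ 0] simp: wavelet_transform_zero)
  then obtain c where c: "c \<in> wavelet_space \<mu> \<pi> g" "c \<in> wavelet_space \<mu> \<rho> h"
      "c \<noteq> L2_class \<mu> (\<lambda>x. 0)"
    using assms(7) by blast
  then obtain f0 k0 where f0: "c = L2_class \<mu> (wavelet_transform \<pi> g f0)"
    and k0: "c = L2_class \<mu> (wavelet_transform \<rho> h k0)"
    unfolding wavelet_space_def by blast
  have common: "wavelet_transform \<pi> g f0 = wavelet_transform \<rho> h k0"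
  proof (rule continuous_AE_eq_imp_eq[OF assms(2)])
    show "continuous_on UNIV (wavelet_transform \<pi> g f0)"
      "continuous_on UNIV (wavelet_transform \<rho> h k0)"
      using \<pi>(1) \<rho>(1) unfolding unitary_representation_def by blast+
    show "AE x in \<mu>. wavelet_transform \<pi> g f0 x = wavelet_transform \<rho> h k0 x"
      using L2_class_eq_imp_AE_eq[OF admissible_square_integrable[OF adm(1)]] f0 k0 by metis
  qed
  have "f0 \<noteq> 0"
    using c(3) unfolding f0 by (intro notI) (simp add: wavelet_transform_zero)
  moreover have "k0 \<noteq> 0"
    using c(3) unfolding k0 by (intro notI) (simp add: wavelet_transform_zero)
  ultimately have nonzero: "f0 \<noteq> 0" "k0 \<noteq> 0" .
  have total: "\<exists>k. wavelet_transform \<pi> g f = wavelet_transform \<rho> h k" for f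
    using ex_equal_wavelet_transform[OF \<pi>(1) \<rho>(1) \<pi>(2) adm common nonzero(1)] .
  have onto: "\<exists>f. wavelet_transform \<rho> h k = wavelet_transform \<pi> g f" for k
    using ex_equal_wavelet_transform[OF \<rho>(1) \<pi>(1) \<rho>(2) adm(2,1) common[symmetric] nonzero(2)] .
  define T where "T f = (SOME k. wavelet_transform \<pi> g f = wavelet_transform \<rho> h k)" for f
  have T: "wavelet_transform \<pi> g f = wavelet_transform \<rho> h (T f)" for f
    unfolding T_def by (rule someI_ex[OF total])
  have T_eqI: "T f = k" if "wavelet_transform \<pi> g f = wavelet_transform \<rho> h k" for f k
    by (rule inj_wavelet_transform[OF adm(2)]) (simp add: that flip: T)
  have isometry: "cinner (T x) (T y) = cinner x y" for x y
    by (rule cinner_eq_if_wavelet_transform_eq[OF adm T T])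
  have surj: "surj T"
  proof (rule surjI)
    show "T (SOME f. wavelet_transform \<rho> h k = wavelet_transform \<pi> g f) = k" for k
      by (rule T_eqI, rule sym, rule someI_ex[OF onto])
  qed
  have "wavelet_space \<mu> \<pi> g = (\<lambda>k. L2_class \<mu> (wavelet_transform \<rho> h k)) ` range T"
    unfolding wavelet_space_def by (simp add: image_image T)
  then have spaces: "wavelet_space \<mu> \<pi> g = wavelet_space \<mu> \<rho> h"
    unfolding wavelet_space_def by (simp add: surj)
  have "clinear_on UNIV T"
    unfolding clinear_on_def
    by (auto intro!: T_eqI simp: wavelet_transform_add wavelet_transform_scaleC T)
  then have "unitary T"
    unfolding unitary_def using surj isometry by blast
  moreover have "T \<circ> \<pi> x = \<rho> x \<circ> T" for x
    by (rule ext) (auto intro!: T_eqI simp: wavelet_transform_left_translate \<pi>(1) \<rho>(1) simp flip: T)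
  moreover have "T g = h"
  proof -
    \<comment> \<open>compare the two transforms of \<open>f\<close> and \<open>T f\<close> at the identity of the group\<close>
    have "cinner (T f) (T g - h) = 0" for f
      using fun_cong[OF T[of f], of 0] isometry[of f g]
      by (simp add: wavelet_transform_def unitary_representation_zero \<pi>(1) \<rho>(1) cinner_diff_right)
    then have "cinner (T g - h) (T g - h) = 0" using surj by (metis surjD)
    then show ?thesis by (simp add: cinner_self)
  qed
  ultimately show ?thesis using spaces by blast
qed

end
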